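(* Let $\Sigma_1$ and $\Sigma_2$ be systems with states $x^i\in\mathbb{R}^{n_i}$, inputs $u^i$ and outputs $y^i$ ($i=1,2$), where $\dim u^1=\dim y^2$ and $\dim u^2=\dim y^1$. Suppose $\Sigma_i$ is $p_i$-dissipative (respectively strictly $p_i$-dissipative), $i=1,2$, both with the same rate $\gamma\ge0$, with incremental supplies $$w^i(\Delta u^i,\Delta y^i)=\begin{bmatrix}\Delta y^i\\ \Delta u^i\end{bmatrix}^{\top}\begin{bmatrix}Q_i&L_i\\ L_i^{\top}&R_i\end{bmatrix}\begin{bmatrix}\Delta y^i\\ \Delta u^i\end{bmatrix},$$ with $Q_i,R_i$ symmetric. Consider the negative feedback interconnection $u^1=-y^2+v^1$, $u^2=y^1+v^2$, with input $v=[v^1;v^2]$, output $y=[y^1;y^2]$ and state $(x^1,x^2)$. Then the interconnection is $(p_1+p_2)$-dissipative (respectively strictly $(p_1+p_2)$-dissipative) with rate $\gamma$ and incremental supply $$\begin{bmatrix}\Delta y\\ \Delta v\end{bmatrix}^{\top}\begin{bmatrix}Q_1+R_2&-L_1+L_2^{\top}&L_1&R_2\\ -L_1^{\top}+L_2&Q_2+R_1&-R_1&L_2\\ L_1^{\top}&-R_1^{\top}&R_1&0\\ R_2&L_2^{\top}&0&R_2\end{bmatrix}\begin{bmatrix}\Delta y\\ \Delta v\end{bmatrix}.$$ In addition, if $$\begin{bmatrix}Q_1+R_2&-L_1+L_2^{\top}\\ -L_1^{\top}+L_2&Q_2+R_1\end{bmatrix}\le 0,$$ then the interconnection is $(p_1+p_2)$-dominant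 (respectively strictly $(p_1+p_2)$-dominant) with rate $\gamma$, i.e. the dominance inequality holds for every pair of its trajectories driven by the same input $v$.
   Context: A trajectory of a system with state $x\in\mathbb{R}^n$, input $u$ and output $y$ has absolutely continuous state and satisfies the system's equations for almost all $t\ge0$. For two trajectories write $\Delta x=x_1-x_2$, $\Delta\dot x=\dot x_1-\dot x_2$, $\Delta u=u_1-u_2$, $\Delta y=y_1-y_2$. A symmetric matrix $P$ has inertia $\{p,0,n-p\}$ if it has $p$ negative and $n-p$ positive eigenvalues. A system is $p$-dissipative with rate $\gamma\ge0$ and incremental supply $w$ (a quadratic form in $(\Delta y,\Delta u)$) if there exist a symmetric $P$ with inertia $\{p,0,n-p\}$ and $\varepsilon\ge0$ such that for every pair of trajectories, for almost all $t$, $$\begin{bmatrix}\Delta\dot x\\ \Delta x\end{bmatrix}^{\top}\begin{bmatrix}0&P\\P&2\gamma P+\varepsilon I\end{bmatrix}\begin{bmatrix}\Delta\dot x\\ \Delta x\end{bmatrix}\le w(\Delta y,\Delta u);$$ strictly $p$-dissipative if this holds with some $\varepsilon>0$. A system is $p$-dominant (strictly $p$-dominant) with rate $\gamma$ if the same inequality holds with right-hand side $0$ for some such $P$ and $\varepsilon\ge0$ ($\varepsilon>0$). *)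

theory Defs
  imports "HOL-Analysis.Analysis" "HOL-Computational_Algebra.Polynomial"
begin

text \<open>A trajectory is a triple (state signal, input signal, output signal), all functions of time.
  A system is identified with its set of trajectories.\<close>

type_synonym ('n, 'u, 'y) traj =
  "(real \<Rightarrow> real^'n) \<times> (real \<Rightarrow> real^'u) \<times> (real \<Rightarrow> real^'y)"

definition abs_cont_on :: "real \<Rightarrow> real \<Rightarrow> (real \<Rightarrow> real^'n::finite) \<Rightarrow> bool" where
  "abs_cont_on a b f \<longleftrightarrow>
     (\<forall>e>0. \<exists>d>0. \<forall>(K::nat set) l r.
        finite K \<longrightarrow>
        (\<forall>k\<in>K. a \<le> l k \<and> l k \<le> r k \<and> r k \<le> b) \<longrightarrow>
        (\<forall>k\<in>K. \<forall>k'\<in>K. k \<noteq> k' \<longrightarrow> {l k<..<r k} \<inter> {l k'<..<r k'} = {}) \<longrightarrow>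
        (\<Sum>k\<in>K. r k - l k) < d \<longrightarrow>
        (\<Sum>k\<in>K. norm (f (r k) - f (l k))) < e)"

definition is_system :: "('n::finite, 'u::finite, 'y::finite) traj set \<Rightarrow> bool" where
  "is_system S \<longleftrightarrow> (\<forall>(x, u, y)\<in>S. \<forall>T\<ge>0. abs_cont_on 0 T x)"

definition charpoly :: "real^'n^'n \<Rightarrow> real poly" where
  "charpoly A = det (\<chi> i j. [: - (A $ i $ j), (if i = j then 1 else 0) :])"

definition has_inertia :: "real^'n^'n \<Rightarrow> nat \<Rightarrow> bool" where
  "has_inertia P p \<longleftrightarrow>
     (\<Sum>r\<in>{r::real. r < 0 \<and> poly (charpoly P) r = 0}. order r (charpoly P)) = p \<and>
     order 0 (charpoly P) = 0 \<and>
     (\<Sum>r\<in>{r::real. r > 0 \<and> poly (charpoly P) r = 0}. order r (charpoly P)) = CARD('n) - p"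

text \<open>[dx; x]^T [[0, P], [P, 2 gamma P + eps I]] [dx; x]\<close>
definition diss_form :: "real^'n^'n \<Rightarrow> real \<Rightarrow> real \<Rightarrow> real^'n \<Rightarrow> real^'n \<Rightarrow> real" where
  "diss_form P \<gamma> \<epsilon> dx x =
     dx \<bullet> ((0::real^'n^'n) *v dx) + dx \<bullet> (P *v x) + x \<bullet> (P *v dx)
     + x \<bullet> (((2 * \<gamma>) *\<^sub>R P + \<epsilon> *\<^sub>R mat 1) *v x)"

definition p_dissipative ::
  "bool \<Rightarrow> ('n::finite, 'u::finite, 'y::finite) traj set \<Rightarrow> nat \<Rightarrow> real \<Rightarrow> (real^'y \<Rightarrow> real^'u \<Rightarrow> real) \<Rightarrow> bool" where
  "p_dissipative strict S p \<gamma> w \<longleftrightarrow>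
     (\<exists>(P::real^'n^'n) \<epsilon>. transpose P = P \<and> has_inertia P p \<and>
        (if strict then \<epsilon> > 0 else \<epsilon> \<ge> 0) \<and>
        (\<forall>(x1, u1, y1)\<in>S. \<forall>(x2, u2, y2)\<in>S.
           AE t in lborel. t \<ge> 0 \<longrightarrow>
             diss_form P \<gamma> \<epsilon> (vector_derivative x1 (at t) - vector_derivative x2 (at t)) (x1 t - x2 t)
               \<le> w (y1 t - y2 t) (u1 t - u2 t)))"

definition p_dominant ::
  "bool \<Rightarrow> ('n::finite, 'u::finite, 'y::finite) traj set \<Rightarrow> nat \<Rightarrow> real \<Rightarrow> bool" where
  "p_dominant strict S p \<gamma> \<longleftrightarrow>
     (\<exists>(P::real^'n^'n) \<epsilon>. transpose P = P \<and> has_inertia P p \<and>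
        (if strict then \<epsilon> > 0 else \<epsilon> \<ge> 0) \<and>
        (\<forall>(x1, u1, y1)\<in>S. \<forall>(x2, u2, y2)\<in>S. (\<forall>t. u1 t = u2 t) \<longrightarrow>
           (AE t in lborel. t \<ge> 0 \<longrightarrow>
             diss_form P \<gamma> \<epsilon> (vector_derivative x1 (at t) - vector_derivative x2 (at t)) (x1 t - x2 t)
               \<le> 0)))"

definition block_supply ::
  "real^'p^'p \<Rightarrow> real^'q^'p \<Rightarrow> real^'q^'q \<Rightarrow> real^'p \<Rightarrow> real^'q \<Rightarrow> real" where
  "block_supply Q L R dy du =
     dy \<bullet> (Q *v dy) + dy \<bullet> (L *v du) + du \<bullet> (transpose L *v dy) + du \<bullet> (R *v du)"

definition vstack :: "real^'a::finite \<Rightarrow> real^'b::finite \<Rightarrow> real^('a + 'b)" where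
  "vstack a b = (\<chi> i. case i of Inl j \<Rightarrow> a $ j | Inr j \<Rightarrow> b $ j)"

definition vtop :: "real^('a::finite + 'b::finite) \<Rightarrow> real^'a" where
  "vtop z = (\<chi> j. z $ Inl j)"

definition vbot :: "real^('a::finite + 'b::finite) \<Rightarrow> real^'b" where
  "vbot z = (\<chi> j. z $ Inr j)"

definition feedback ::
  "('n1::finite, 'q::finite, 'p::finite) traj set \<Rightarrow> ('n2::finite, 'p, 'q) traj set \<Rightarrow> ('n1 + 'n2, 'q + 'p, 'p + 'q) traj set" where
  "feedback S1 S2 = {(x, v, y). \<exists>x1 u1 y1 x2 u2 y2.
      (x1, u1, y1) \<in> S1 \<and> (x2, u2, y2) \<in> S2 \<and>
      (\<forall>t. x t = vstack (x1 t) (x2 t) \<and> y t = vstack (y1 t) (y2 t) \<and>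
           u1 t = - y2 t + vtop (v t) \<and> u2 t = y1 t + vbot (v t))}"

text \<open>The interconnection supply: [dy; dv]^T M [dy; dv] with the 4x4 block matrix M,
  written out block by block with dy = [a; b], dv = [c; d].\<close>
definition fb_supply ::
  "real^'p::finite^'p \<Rightarrow> real^'q::finite^'p \<Rightarrow> real^'q^'q \<Rightarrow> real^'q^'q \<Rightarrow> real^'p^'q \<Rightarrow> real^'p^'p
   \<Rightarrow> real^('p + 'q) \<Rightarrow> real^('q + 'p) \<Rightarrow> real" where
  "fb_supply Q1 L1 R1 Q2 L2 R2 dy dv =
    (let a = vtop dy; b = vbot dy; c = vtop dv; d = vbot dv in
       a \<bullet> ((Q1 + R2) *v a) + a \<bullet> ((- L1 + transpose L2) *v b) + a \<bullet> (L1 *v c) + a \<bullet> (R2 *v d)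
     + b \<bullet> ((- transpose L1 + L2) *v a) + b \<bullet> ((Q2 + R1) *v b) + b \<bullet> ((- R1) *v c) + b \<bullet> (L2 *v d)
     + c \<bullet> (transpose L1 *v a) + c \<bullet> ((- transpose R1) *v b) + c \<bullet> (R1 *v c) + c \<bullet> ((0::real^'p^'q) *v d)
     + d \<bullet> (R2 *v a) + d \<bullet> (transpose L2 *v b) + d \<bullet> ((0::real^'q^'p) *v c) + d \<bullet> (R2 *v d))"

definition fb_lmi ::
  "real^'p^'p \<Rightarrow> real^'q^'p \<Rightarrow> real^'q^'q \<Rightarrow> real^'q^'q \<Rightarrow> real^'p^'q \<Rightarrow> real^'p^'p \<Rightarrow> bool" where
  "fb_lmi Q1 L1 R1 Q2 L2 R2 \<longleftrightarrow>
     (\<forall>a b. a \<bullet> ((Q1 + R2) *v a) + a \<bullet> ((- L1 + transpose L2) *v b)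
          + b \<bullet> ((- transpose L1 + L2) *v a) + b \<bullet> ((Q2 + R1) *v b) \<le> 0)"

end

theory Submission
  imports Defs
begin

text \<open>
  With P1, P2 the storage matrices of the two systems, the interconnection has the storage matrix
  diag(P1, P2): its characteristic polynomial is the product of the two, so inertias add, and
  the two supplies, evaluated at the interconnection inputs, add up to the stated supply.

  The one analytic point is that the derivative of the stacked state is the stack of the derivatives
  only where both parts are differentiable, since vector derivatives elsewhere are arbitrary values.
  Hence one needs Lebesgue's theorem that absolutely continuous functions are differentiable almost
  everywhere. Each component is the difference of two continuous monotone functions, built from
  the total variation, and a continuous monotone function is differentiable almost everywhere by a
  Vitali covering argument with its Stieltjes measure.
\<close>

section \<open>Inertia of block diagonal matrices\<close>

text \<open>The entry type only needs a zero because the matrices are real ones as well as the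
  polynomial ones whose determinant is \<open>charpoly\<close>.\<close>

definition block_diag :: "'a::zero^'m::finite^'m \<Rightarrow> 'a^'n::finite^'n \<Rightarrow> 'a^('m + 'n)^('m + 'n)" where
  "block_diag A B = (\<chi> i j. case i of
      Inl a \<Rightarrow> (case j of Inl b \<Rightarrow> A $ a $ b | Inr _ \<Rightarrow> 0)
    | Inr a \<Rightarrow> (case j of Inl _ \<Rightarrow> 0 | Inr b \<Rightarrow> B $ a $ b))"

lemma block_diag_nth [simp]:
  "block_diag A B $ Inl a $ Inl b = A $ a $ b"
  "block_diag A B $ Inl a $ Inr d = 0"
  "block_diag A B $ Inr c $ Inl b = 0"
  "block_diag A B $ Inr c $ Inr d = B $ c $ d"
  by (simp_all add: block_diag_def)

section \<open>Permutations of a disjoint sum and the Leibniz formula\<close>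

lemma permutation_finite: "p permutes (UNIV::'a::finite set) \<Longrightarrow> permutation p"
  by (auto simp: permutation_permutes)

lemma map_sum_permutes:
  assumes "p permutes (UNIV::'a set)" "q permutes (UNIV::'b set)"
  shows "map_sum p q permutes UNIV"
proof (rule bij_imp_permutes)
  have "inj (map_sum p q)"
    using assms by (intro sum.inj_map permutes_inj)
  moreover have "surj (map_sum p q)"
  proof (rule surjI)
    show "map_sum p q (map_sum (inv p) (inv q) z) = z" for z
      using assms by (cases z) (simp_all add: permutes_inverses)
  qed
  ultimately show "bij (map_sum p q)" by (rule bijI)
qed auto

text \<open>\<open>map_sum p q\<close> is the composition of \<open>map_sum p id\<close> and
  \<open>map_sum id q\<close>. Each factor is a permutation transported along an injection and
  extended by the identity, which preserves the sign.\<close>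

lemma sign_map_sum:
  assumes p: "p permutes (UNIV::'a::finite set)" and q: "q permutes (UNIV::'b::finite set)"
  shows "sign (map_sum p q) = sign p * sign q"
proof -
  have l: "map_sum p id = map_permutation UNIV (Inl :: 'a \<Rightarrow> 'a + 'b) p"
    by (auto simp: fun_eq_iff map_permutation_def restrict_id_def map_sum_def split: sum.splits)
  have r: "map_sum id q = map_permutation UNIV (Inr :: 'b \<Rightarrow> 'a + 'b) q"
    by (auto simp: fun_eq_iff map_permutation_def restrict_id_def map_sum_def split: sum.splits)
  have "map_sum p q = map_sum p id \<circ> map_sum id q"
    by (simp add: map_sum.comp)
  moreover have "permutation (map_sum p (id::'b \<Rightarrow> 'b))" "permutation (map_sum (id::'a\<Rightarrow>'a) q)"
    by (intro permutation_finite map_sum_permutes p q permutes_id)+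
  moreover have "sign (map_sum p (id::'b\<Rightarrow>'b)) = sign p" "sign (map_sum (id::'a\<Rightarrow>'a) q) = sign q"
    unfolding l r by (intro sign_map_permutation p q inj_Inl inj_Inr finite)+
  ultimately show ?thesis by (simp add: sign_compose)
qed

text \<open>In the Leibniz formula only permutations that keep both summands of the index type
  contribute. These are the \<open>map_sum p q\<close>, so the sum factors into two Leibniz
  sums.\<close>

lemma det_block_diag:
  fixes A :: "'a::comm_ring_1^'m::finite^'m" and B :: "'a^'n::finite^'n"
  shows "det (block_diag A B) = det A * det B"
proof -
  let ?P = "{p. p permutes (UNIV::'m set)}" and ?Q = "{q. q permutes (UNIV::'n set)}"
  let ?R = "{r. r permutes (UNIV::('m + 'n) set)}"
  let ?f = "\<lambda>(p::'m\<Rightarrow>'m, q::'n\<Rightarrow>'n). map_sum p q"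
  let ?t = "\<lambda>r. of_int (sign r) * (\<Prod>i\<in>UNIV. block_diag A B $ i $ r i)"
  have inj: "inj_on ?f (?P \<times> ?Q)"
  proof (rule inj_onI, clarsimp)
    fix p q p' q' assume eq: "map_sum p q = map_sum p' q'"
    have "p x = p' x" for x using fun_cong[OF eq, of "Inl x"] by simp
    moreover have "q x = q' x" for x using fun_cong[OF eq, of "Inr x"] by simp
    ultimately show "p = p' \<and> q = q'" by auto
  qed
  have sub: "?f ` (?P \<times> ?Q) \<subseteq> ?R"
    by (auto intro: map_sum_permutes)
  have zero: "?t r = 0" if r: "r \<in> ?R - ?f ` (?P \<times> ?Q)" for r
  proof (rule ccontr)
    assume nz: "?t r \<noteq> 0"
    have nz': "block_diag A B $ i $ r i \<noteq> 0" for i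
    proof
      assume "block_diag A B $ i $ r i = 0"
      then have "(\<Prod>i\<in>UNIV. block_diag A B $ i $ r i) = 0"
        by (subst prod.remove[of _ i]) auto
      with nz show False by simp
    qed
    \<comment> \<open>A nonzero product has no factor from an off-diagonal block, so
      \<open>r\<close> cannot move an index to the other summand.\<close>
    have l: "\<exists>b. r (Inl a) = Inl b" for a
      using nz'[of "Inl a"] by (cases "r (Inl a)") auto
    have rr: "\<exists>b. r (Inr a) = Inr b" for a
      using nz'[of "Inr a"] by (cases "r (Inr a)") auto
    obtain p where p: "\<And>a. r (Inl a) = Inl (p a)" using l by metis
    obtain q where q: "\<And>a. r (Inr a) = Inr (q a)" using rr by metis
    have r_eq: "r = map_sum p q"
      by (rule ext) (metis p q map_sum.simps sum.exhaust)
    have injr: "inj r" using r permutes_inj by blast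
    have "inj p" using p injr by (metis injD injI sum.inject(1))
    moreover have "inj q" using q injr by (metis injD injI sum.inject(2))
    ultimately have "p \<in> ?P" "q \<in> ?Q"
      by (auto intro!: bij_imp_permutes simp: bij_def finite_UNIV_inj_surj)
    then have "r \<in> ?f ` (?P \<times> ?Q)" unfolding r_eq by auto
    with r show False by simp
  qed
  have summand: "?t (map_sum p q) = (of_int (sign p) * (\<Prod>i\<in>UNIV. A $ i $ p i)) *
      (of_int (sign q) * (\<Prod>i\<in>UNIV. B $ i $ q i))"
    if "p \<in> ?P" "q \<in> ?Q" for p q
  proof -
    have "(\<Prod>i\<in>UNIV. block_diag A B $ i $ map_sum p q i)
        = (\<Prod>i\<in>range Inl. block_diag A B $ i $ map_sum p q i) *
          (\<Prod>i\<in>range Inr. block_diag A B $ i $ map_sum p q i)"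
      unfolding UNIV_sum by (rule prod.union_disjoint) auto
    also have "\<dots> = (\<Prod>i\<in>UNIV. A $ i $ p i) * (\<Prod>i\<in>UNIV. B $ i $ q i)"
      by (simp add: prod.reindex)
    finally show ?thesis using that by (simp add: sign_map_sum mult_ac)
  qed
  have "det (block_diag A B) = sum ?t ?R" by (simp add: det_def)
  also have "\<dots> = sum ?t (?f ` (?P \<times> ?Q))"
    by (rule sum.mono_neutral_right) (use sub zero in auto)
  also have "\<dots> = (\<Sum>(p,q)\<in>?P \<times> ?Q. ?t (map_sum p q))"
    by (subst sum.reindex[OF inj]) (simp add: case_prod_unfold)
  also have "\<dots> = (\<Sum>(p,q)\<in>?P \<times> ?Q. (of_int (sign p) * (\<Prod>i\<in>UNIV. A $ i $ p i)) *
      (of_int (sign q) * (\<Prod>i\<in>UNIV. B $ i $ q i)))"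
    by (rule sum.cong) (use summand in auto)
  also have "\<dots> = det A * det B"
    by (simp add: det_def sum_product sum.cartesian_product)
  finally show ?thesis .
qed

lemma charpoly_block_diag: "charpoly (block_diag A B) = charpoly A * charpoly B"
proof -
  have "(\<chi> i j. [: - (block_diag A B $ i $ j), (if i = j then 1 else 0) :])
     = block_diag (\<chi> i j. [: - (A $ i $ j), (if i = j then 1 else 0) :])
         (\<chi> i j. [: - (B $ i $ j), (if i = j then 1 else 0) :])"
    by (auto simp: vec_eq_iff block_diag_def split: sum.splits)
  then show ?thesis by (simp add: charpoly_def det_block_diag)
qed

section \<open>Counting eigenvalues by root multiplicities\<close>

lemma degree_charpoly_le: "degree (charpoly (A::real^'n^'n)) \<le> CARD('n)"
  unfolding charpoly_def det_def
proof (rule degree_sum_le)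
  fix p :: "'n \<Rightarrow> 'n"
  let ?M = "\<chi> i j. [: - (A $ i $ j), (if i = j then 1 else 0) :]"
  have "degree (of_int (sign p) * (\<Prod>i\<in>UNIV. ?M $ i $ p i)) \<le> degree (\<Prod>i\<in>UNIV. ?M $ i $ p i)"
    by (rule order_trans[OF degree_mult_le]) simp
  also have "\<dots> \<le> (\<Sum>i\<in>UNIV. degree (?M $ i $ p i))"
    using degree_prod_sum_le[of UNIV "\<lambda>i. ?M $ i $ p i"] by (simp add: o_def)
  also have "\<dots> \<le> (\<Sum>i\<in>(UNIV::'n set). 1)"
    by (rule sum_mono) simp
  finally show "degree (of_int (sign p) * (\<Prod>i\<in>UNIV. ?M $ i $ p i)) \<le> CARD('n)"
    by simp
qed simp

text \<open>For the zero polynomial both root sets would be infinite half-lines, over which sums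
  take the default value 0. This would give \<open>p = 0\<close> together with
  \<open>CARD('n) \<le> p\<close>.\<close>

lemma has_inertia_imp_charpoly_nonzero:
  fixes P :: "real^'n^'n"
  assumes "has_inertia P p"
  shows "charpoly P \<noteq> 0"
proof
  assume 0: "charpoly P = 0"
  have "\<not> finite {r::real. r < 0}" "\<not> finite {r::real. r > 0}"
    using infinite_Iio[of "0::real"] infinite_Ioi[of "0::real"]
    unfolding lessThan_def greaterThan_def by blast+
  then have "p = 0 \<and> CARD('n) \<le> p"
    using assms unfolding has_inertia_def 0 by auto
  then show False using zero_less_card_finite[where 'a='n] by linarith
qed

text \<open>This bound makes the truncated subtraction \<open>CARD('n) - p\<close> in
  \<open>has_inertia\<close> a true one, so that the positive counts of two matrices add up.\<close>

lemma has_inertia_le_card: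
  fixes P :: "real^'n^'n"
  assumes "has_inertia P p"
  shows "p \<le> CARD('n)"
proof -
  note nz = has_inertia_imp_charpoly_nonzero[OF assms]
  have "p = (\<Sum>r\<in>{r::real. r < 0 \<and> poly (charpoly P) r = 0}. order r (charpoly P))"
    using assms by (simp add: has_inertia_def)
  also have "\<dots> \<le> (\<Sum>r | poly (charpoly P) r = 0. order r (charpoly P))"
    by (rule sum_mono2) (auto simp: poly_roots_finite nz)
  also have "\<dots> \<le> CARD('n)"
    using sum_order_le_degree[OF nz] degree_charpoly_le order_trans by blast
  finally show ?thesis .
qed

text \<open>\<open>order\<close> is additive on products, and it vanishes at non-roots, so both sums
  may be extended to the common root set. The predicate \<open>R\<close> serves for negative and
  positive roots alike.\<close>

lemma sum_order_roots_mult: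
  fixes p q :: "real poly"
  assumes "p \<noteq> 0" "q \<noteq> 0"
  shows "(\<Sum>r | R r \<and> poly (p * q) r = 0. order r (p * q)) =
    (\<Sum>r | R r \<and> poly p r = 0. order r p) + (\<Sum>r | R r \<and> poly q r = 0. order r q)"
proof -
  let ?U = "{r. R r \<and> poly (p * q) r = 0}"
  have fin: "finite ?U"
    using poly_roots_finite[of "p * q"] assms by (auto intro: finite_subset[rotated])
  have "(\<Sum>r\<in>?U. order r (p * q)) = (\<Sum>r\<in>?U. order r p) + (\<Sum>r\<in>?U. order r q)"
    using assms by (simp add: order_mult sum.distrib)
  also have "(\<Sum>r\<in>?U. order r p) = (\<Sum>r | R r \<and> poly p r = 0. order r p)"
    by (rule sum.mono_neutral_right) (use fin in \<open>auto simp: order_0I\<close>)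
  also have "(\<Sum>r\<in>?U. order r q) = (\<Sum>r | R r \<and> poly q r = 0. order r q)"
    by (rule sum.mono_neutral_right) (use fin in \<open>auto simp: order_0I\<close>)
  finally show ?thesis .
qed

lemma has_inertia_block_diag:
  fixes P1 :: "real^'m::finite^'m" and P2 :: "real^'n::finite^'n"
  assumes "has_inertia P1 p1" "has_inertia P2 p2"
  shows "has_inertia (block_diag P1 P2) (p1 + p2)"
proof -
  note nz = assms[THEN has_inertia_imp_charpoly_nonzero]
  note le = assms[THEN has_inertia_le_card]
  show ?thesis
    using assms le
    unfolding has_inertia_def charpoly_block_diag
    by (simp only: sum_order_roots_mult[OF nz]) (simp add: order_mult nz)
qed

section \<open>Stacked vectors and supply rates\<close>

lemma vtop_vstack [simp]: "vtop (vstack a b) = a"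
  and vbot_vstack [simp]: "vbot (vstack a b) = b"
  by (simp_all add: vtop_def vbot_def vstack_def vec_eq_iff)

lemma vstack_diff: "vstack a b - vstack c d = vstack (a - c) (b - d)"
  by (simp add: vstack_def vec_eq_iff split: sum.splits)

lemma vtop_diff: "vtop (a - b) = vtop a - vtop b"
  and vbot_diff: "vbot (a - b) = vbot a - vbot b"
  by (simp_all add: vtop_def vbot_def vec_eq_iff)

lemma sum_UNIV_Plus:
  fixes f :: "'a::finite + 'b::finite \<Rightarrow> 'c::comm_monoid_add"
  shows "(\<Sum>i\<in>UNIV. f i) = (\<Sum>i\<in>UNIV. f (Inl i)) + (\<Sum>i\<in>UNIV. f (Inr i))"
proof -
  have "(\<Sum>i\<in>UNIV. f i) = sum f (range Inl) + sum f (range Inr)"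
    unfolding UNIV_sum by (rule sum.union_disjoint) auto
  then show ?thesis by (simp add: sum.reindex)
qed

lemma inner_vstack: "vstack a b \<bullet> vstack c d = a \<bullet> c + b \<bullet> d"
  by (simp add: inner_vec_def sum_UNIV_Plus vstack_def)

lemma block_diag_mult_vstack: "block_diag A B *v vstack a b = vstack (A *v a) (B *v b)"
  by (simp add: vec_eq_iff matrix_vector_mult_def sum_UNIV_Plus vstack_def block_diag_def split: sum.splits)

lemma transpose_block_diag: "transpose (block_diag A B) = block_diag (transpose A) (transpose B)"
  by (simp add: vec_eq_iff transpose_def block_diag_def split: sum.splits)

section \<open>Dissipation forms and supplies of the interconnection\<close>

lemma diss_form_eq:
  "diss_form P \<gamma> \<epsilon> dx x =
     dx \<bullet> (P *v x) + x \<bullet> (P *v dx) + 2 * \<gamma> * (x \<bullet> (P *v x)) + \<epsilon> * (x \<bullet> x)"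
  by (simp add: diss_form_def matrix_vector_mult_add_rdistrib inner_add_right
      scaleR_matrix_vector_assoc[symmetric])

lemma diss_form_block_diag:
  "diss_form (block_diag P1 P2) \<gamma> \<epsilon> (vstack dx1 dx2) (vstack x1 x2) =
     diss_form P1 \<gamma> \<epsilon> dx1 x1 + diss_form P2 \<gamma> \<epsilon> dx2 x2"
  by (simp add: diss_form_eq block_diag_mult_vstack inner_vstack algebra_simps)

text \<open>Allows the inequalities of both systems to be weakened to one common constant, the
  smaller of the two.\<close>

lemma diss_form_mono: "\<epsilon> \<le> \<epsilon>' \<Longrightarrow> diss_form P \<gamma> \<epsilon> dx x \<le> diss_form P \<gamma> \<epsilon>' dx x"
  by (simp add: diss_form_eq mult_right_mono)

lemma uminus_matrix_vector_mult: "(- A) *v x = - (A *v (x::real^'n))"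
  by (simp add: vec_eq_iff matrix_vector_mult_def sum_negf)

text \<open>The interconnection equations are substituted into the two supplies and everything is
  expanded bilinearly. Symmetry of \<open>R1\<close> matches the block \<open>- transpose R1\<close>
  with the expanded term.\<close>

lemma fb_supply_eq_block_supply:
  assumes "transpose R1 = R1"
  shows "fb_supply Q1 L1 R1 Q2 L2 R2 (vstack a b) dv =
    block_supply Q1 L1 R1 a (vtop dv - b) + block_supply Q2 L2 R2 b (a + vbot dv)"
  unfolding fb_supply_def block_supply_def Let_def vtop_vstack vbot_vstack assms
    matrix_vector_mult_add_rdistrib uminus_matrix_vector_mult matrix_vector_mult_diff_distrib
    matrix_vector_right_distrib inner_add_left inner_add_right inner_diff_left inner_diff_right
    inner_minus_right matrix_vector_mult_0 inner_zero_right
  by linarith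

text \<open>Without external input difference only the four upper left blocks survive, and these
  form the matrix of \<open>fb_lmi\<close>.\<close>

lemma fb_supply_zero_le:
  assumes "fb_lmi Q1 L1 R1 Q2 L2 R2"
  shows "fb_supply Q1 L1 R1 Q2 L2 R2 dy 0 \<le> 0"
  using assms by (simp add: fb_supply_def fb_lmi_def Let_def vtop_def vbot_def zero_vec_def[symmetric])

text \<open>\<open>vstack\<close> is the sum of two bounded linear maps, one in each
  argument.\<close>

lemma has_vector_derivative_vstack:
  assumes "(f has_vector_derivative f') (at t)" "(g has_vector_derivative g') (at t)"
  shows "((\<lambda>t. vstack (f t) (g t)) has_vector_derivative vstack f' g') (at t)"
proof -
  have lin: "bounded_linear (\<lambda>a. vstack a (0::real^'b::finite))" "bounded_linear (vstack (0::real^'a::finite))"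
    by (auto intro!: linear_conv_bounded_linear[THEN iffD1] linearI
        simp: vstack_def vec_eq_iff split: sum.splits)
  have split: "vstack a b = vstack a 0 + vstack 0 b" for a :: "real^'a::finite" and b :: "real^'b::finite"
    by (simp add: vstack_def vec_eq_iff split: sum.splits)
  show ?thesis
    by (subst (1 2) split)
      (intro has_vector_derivative_add bounded_linear.has_vector_derivative[OF lin(1)]
        bounded_linear.has_vector_derivative[OF lin(2)] assms)
qed

section \<open>Variation of absolutely continuous functions\<close>

text \<open>Isolates the interval families of \<open>abs_cont_on\<close>. Degenerate intervals are
  allowed, so a family can be clamped to a subinterval without removing members.\<close>

definition nonoverlapping_in :: "real \<Rightarrow> real \<Rightarrow> nat set \<Rightarrow> (nat \<Rightarrow> real) \<Rightarrow> (nat \<Rightarrow> real) \<Rightarrow> bool" where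
  "nonoverlapping_in a b K l r \<longleftrightarrow> finite K \<and>
     (\<forall>k\<in>K. a \<le> l k \<and> l k \<le> r k \<and> r k \<le> b) \<and>
     (\<forall>k\<in>K. \<forall>k'\<in>K. k \<noteq> k' \<longrightarrow> {l k<..<r k} \<inter> {l k'<..<r k'} = {})"

text \<open>The supremum of this set is the total variation of \<open>f\<close>. The families need
  not cover the interval, in agreement with absolute continuity.\<close>

definition variation_sums :: "(real \<Rightarrow> 'a::real_normed_vector) \<Rightarrow> real \<Rightarrow> real \<Rightarrow> real set" where
  "variation_sums f a b =
     {(\<Sum>k\<in>K. norm (f (r k) - f (l k))) | K l r. nonoverlapping_in a b K l r}"

lemma abs_cont_on_iff_nonoverlapping:
  "abs_cont_on a b f \<longleftrightarrow>
     (\<forall>e>0. \<exists>d>0. \<forall>K l r. nonoverlapping_in a b K l r \<longrightarrow> (\<Sum>k\<in>K. r k - l k) < d \<longrightarrow>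
        (\<Sum>k\<in>K. norm (f (r k) - f (l k))) < e)"
  unfolding abs_cont_on_def nonoverlapping_in_def by (simp only: imp_conjL)

lemma zero_in_variation_sums: "0 \<in> variation_sums f a b"
  unfolding variation_sums_def nonoverlapping_in_def by (force intro: exI[of _ "{}"])

text \<open>The open intervals are disjoint subsets of \<open>{a..b}\<close>, so their Lebesgue
  measures add up to at most that of \<open>{a..b}\<close>.\<close>

lemma nonoverlapping_in_length_le:
  assumes "nonoverlapping_in a b K l r" "a \<le> b"
  shows "(\<Sum>k\<in>K. r k - l k) \<le> b - a"
proof -
  have "ennreal (\<Sum>k\<in>K. r k - l k) = (\<Sum>k\<in>K. ennreal (r k - l k))"
    by (rule sum_ennreal[symmetric]) (use assms in \<open>simp add: nonoverlapping_in_def\<close>)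
  also have "\<dots> = (\<Sum>k\<in>K. emeasure lborel {l k<..<r k})"
    by (rule sum.cong) (use assms in \<open>simp_all add: nonoverlapping_in_def\<close>)
  also have "\<dots> = emeasure lborel (\<Union>k\<in>K. {l k<..<r k})"
    by (rule sum_emeasure) (use assms in \<open>auto simp: nonoverlapping_in_def disjoint_family_on_def\<close>)
  also have "\<dots> \<le> emeasure lborel {a..b}"
    by (rule emeasure_mono) (use assms in \<open>force simp: nonoverlapping_in_def\<close>)+
  also have "\<dots> = ennreal (b - a)" using assms by simp
  finally show ?thesis using assms by simp
qed

text \<open>A family inside a subinterval shorter than \<open>d\<close> has total length below
  \<open>d\<close>, so the constant of absolute continuity serves all short subintervals at
  once.\<close>

lemma abs_cont_on_variation_sums_small:
  assumes "abs_cont_on a b f" "0 < e"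
  obtains d where "0 < d"
    "\<And>a' b' s. \<lbrakk>a \<le> a'; a' \<le> b'; b' \<le> b; b' - a' < d; s \<in> variation_sums f a' b'\<rbrakk> \<Longrightarrow> s < e"
proof -
  obtain d where d: "0 < d" and D: "\<And>K l r. \<lbrakk>nonoverlapping_in a b K l r; (\<Sum>k\<in>K. r k - l k) < d\<rbrakk>
      \<Longrightarrow> (\<Sum>k\<in>K. norm (f (r k) - f (l k))) < e"
    using assms unfolding abs_cont_on_iff_nonoverlapping by meson
  have "s < e" if H: "a \<le> a'" "a' \<le> b'" "b' \<le> b" "b' - a' < d" "s \<in> variation_sums f a' b'" for a' b' s
  proof -
    obtain K l r where s: "s = (\<Sum>k\<in>K. norm (f (r k) - f (l k)))" and n: "nonoverlapping_in a' b' K l r"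
      using H(5) by (auto simp: variation_sums_def)
    have "nonoverlapping_in a b K l r" using n H(1,3) by (force simp: nonoverlapping_in_def)
    moreover have "(\<Sum>k\<in>K. r k - l k) < d" using nonoverlapping_in_length_le[OF n H(2)] H(4) by simp
    ultimately show ?thesis using D s by blast
  qed
  with d show ?thesis by (rule that)
qed

text \<open>Yields subadditivity of the variation. The triangle inequality through
  \<open>f b\<close> compares each term with those of its two parts.\<close>

lemma variation_sums_split:
  assumes "s \<in> variation_sums f a c" "a \<le> b" "b \<le> c"
  obtains s1 s2 where "s1 \<in> variation_sums f a b" "s2 \<in> variation_sums f b c" "s \<le> s1 + s2"
proof -
  obtain K l r where s: "s = (\<Sum>k\<in>K. norm (f (r k) - f (l k)))" and n: "nonoverlapping_in a c K l r"
    using assms(1) by (auto simp: variation_sums_def)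
  \<comment> \<open>Clamping the endpoints at b splits every interval of the family without re-indexing it.\<close>
  define l1 r1 l2 r2 where "l1 = (\<lambda>k. min (l k) b)" and "r1 = (\<lambda>k. min (r k) b)"
    and "l2 = (\<lambda>k. max (l k) b)" and "r2 = (\<lambda>k. max (r k) b)"
  have sub: "{l1 k<..<r1 k} \<subseteq> {l k<..<r k}" "{l2 k<..<r2 k} \<subseteq> {l k<..<r k}" for k
    by (auto simp: l1_def r1_def l2_def r2_def)
  have "nonoverlapping_in a b K l1 r1"
    unfolding nonoverlapping_in_def
  proof (intro conjI ballI impI)
    show "{l1 k<..<r1 k} \<inter> {l1 k'<..<r1 k'} = {}" if "k \<in> K" "k' \<in> K" "k \<noteq> k'" for k k'
      using n that sub(1)[of k] sub(1)[of k'] unfolding nonoverlapping_in_def by blast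
  qed (use n assms in \<open>force simp: nonoverlapping_in_def l1_def r1_def\<close>)+
  then have 1: "(\<Sum>k\<in>K. norm (f (r1 k) - f (l1 k))) \<in> variation_sums f a b"
    by (auto simp: variation_sums_def)
  have "nonoverlapping_in b c K l2 r2"
    unfolding nonoverlapping_in_def
  proof (intro conjI ballI impI)
    show "{l2 k<..<r2 k} \<inter> {l2 k'<..<r2 k'} = {}" if "k \<in> K" "k' \<in> K" "k \<noteq> k'" for k k'
      using n that sub(2)[of k] sub(2)[of k'] unfolding nonoverlapping_in_def by blast
  qed (use n assms in \<open>force simp: nonoverlapping_in_def l2_def r2_def\<close>)+
  then have 2: "(\<Sum>k\<in>K. norm (f (r2 k) - f (l2 k))) \<in> variation_sums f b c"
    by (auto simp: variation_sums_def)
  have "norm (f (r k) - f (l k)) \<le> norm (f (r1 k) - f (l1 k)) + norm (f (r2 k) - f (l2 k))"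
    if "k \<in> K" for k
  proof -
    have lr: "l k \<le> r k" using n that by (simp add: nonoverlapping_in_def)
    have "norm (f (r k) - f (l k)) \<le> norm (f b - f (l k)) + norm (f (r k) - f b)"
      using norm_triangle_ineq[of "f b - f (l k)" "f (r k) - f b"] by simp
    then show ?thesis
      using lr by (cases "r k \<le> b"; cases "l k \<le> b")
        (simp_all add: l1_def r1_def l2_def r2_def min_def max_def)
  qed
  then have "s \<le> (\<Sum>k\<in>K. norm (f (r1 k) - f (l1 k))) + (\<Sum>k\<in>K. norm (f (r2 k) - f (l2 k)))"
    unfolding s sum.distrib[symmetric] by (rule sum_mono)
  with 1 2 show ?thesis by (rule that)
qed

text \<open>The interval from \<open>b\<close> to \<open>c\<close> is appended under a fresh index.
  This half of additivity makes the increments of the variation dominate those of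
  \<open>f\<close>.\<close>

lemma variation_sums_extend:
  assumes "s \<in> variation_sums f a b" "a \<le> b" "b \<le> c"
  shows "s + norm (f c - f b) \<in> variation_sums f a c"
proof -
  obtain K l r where s: "s = (\<Sum>k\<in>K. norm (f (r k) - f (l k)))" and n: "nonoverlapping_in a b K l r"
    using assms(1) by (auto simp: variation_sums_def)
  have fin: "finite K" using n by (simp add: nonoverlapping_in_def)
  obtain m where m: "m \<notin> K" using fin ex_new_if_finite infinite_UNIV_nat by blast
  have K: "k \<noteq> m" if "k \<in> K" for k using m that by blast
  have "nonoverlapping_in a c (insert m K) (l(m := b)) (r(m := c))"
    using n assms(2,3) K unfolding nonoverlapping_in_def by (force simp: disjoint_iff)
  then have "(\<Sum>k\<in>insert m K. norm (f ((r(m := c)) k) - f ((l(m := b)) k))) \<in> variation_sums f a c"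
    unfolding variation_sums_def by blast
  moreover have "(\<Sum>k\<in>insert m K. norm (f ((r(m := c)) k) - f ((l(m := b)) k))) = s + norm (f c - f b)"
    using fin m K by (simp add: s cong: sum.cong)
  ultimately show ?thesis by (simp only:)
qed

lemma abs_cont_on_imp_bdd_above_variation_sums:
  assumes ac: "abs_cont_on a b f"
  shows "bdd_above (variation_sums f a b)"
proof (cases "a \<le> b")
  case False
  \<comment> \<open>With \<open>b < a\<close> no interval fits, so only the empty family
    remains.\<close>
  have "variation_sums f a b \<subseteq> {0}"
  proof
    fix s assume "s \<in> variation_sums f a b"
    then obtain K l r where s: "s = (\<Sum>k\<in>K. norm (f (r k) - f (l k)))"
      and n: "nonoverlapping_in a b K l r" by (auto simp: variation_sums_def)
    have "K = {}" using n False by (force simp: nonoverlapping_in_def)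
    then show "s \<in> {0}" by (simp add: s)
  qed
  then show ?thesis by (rule bdd_above_mono[rotated]) simp
next
  case True
  obtain d where d: "0 < d"
    and D: "\<And>a' b' s. \<lbrakk>a \<le> a'; a' \<le> b'; b' \<le> b; b' - a' < d; s \<in> variation_sums f a' b'\<rbrakk> \<Longrightarrow> s < 1"
    using abs_cont_on_variation_sums_small[OF ac, of 1] by auto
  \<comment> \<open>Induction on the number \<open>n\<close> of pieces of length
    \<open>d / 2\<close>, each with variation sums below 1. The bound \<open>Suc n\<close> also
    covers \<open>n = 0\<close>, where the interval is a single point.\<close>
  have bound: "s \<le> Suc n" if "a \<le> b'" "b' \<le> b" "b' - a \<le> n * (d / 2)" "s \<in> variation_sums f a b'" for n :: nat and b' s :: real
    using that
  proof (induction n arbitrary: b' s)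
    case 0
    then show ?case using D[of a b' s] d by simp
  next
    case (Suc n)
    \<comment> \<open>The last piece has length at most \<open>d / 2\<close>, hence strictly below
      \<open>d\<close>; the maximum keeps the cut inside the interval.\<close>
    define c where "c = max a (b' - d / 2)"
    have "0 \<le> n * (d / 2)" using d by simp
    then have c: "a \<le> c" "c \<le> b'" "c - a \<le> n * (d / 2)" "b' - c < d"
      using Suc.prems d by (auto simp: c_def max_def algebra_simps)
    obtain s1 s2 where s: "s1 \<in> variation_sums f a c" "s2 \<in> variation_sums f c b'" "s \<le> s1 + s2"
      using variation_sums_split[OF Suc.prems(4) c(1,2)] by blast
    have "s1 \<le> Suc n" using Suc.IH[of c s1] c s Suc.prems by simp
    moreover have "s2 < 1" using D[of c b' s2] c s Suc.prems by simp
    ultimately show ?case using s(3) by simp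
  qed
  obtain n :: nat where "(b - a) / (d / 2) \<le> n" using real_arch_simple by blast
  then have "b - a \<le> n * (d / 2)" using d by (simp add: field_simps)
  then show ?thesis using bound[of b n] True by (intro bdd_aboveI) auto
qed

text \<open>The majorant is the total variation from \<open>a\<close>. Its increments dominate those
  of \<open>f\<close> by extension of families, and it is continuous because short intervals carry
  small variation.\<close>

lemma abs_cont_on_imp_monotone_majorant:
  fixes f :: "real \<Rightarrow> real^'n::finite"
  assumes ac: "abs_cont_on a b f" and ab: "a \<le> b"
  obtains V :: "real \<Rightarrow> real" where
    "\<And>s t. \<lbrakk>a \<le> s; s \<le> t; t \<le> b\<rbrakk> \<Longrightarrow> norm (f t - f s) \<le> V t - V s"
    "continuous_on {a..b} V"
proof -
  define V where "V t = Sup (variation_sums f a t)" for t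
  have sub: "variation_sums f a t \<subseteq> variation_sums f a b" if "t \<le> b" for t
    using that by (force simp: variation_sums_def nonoverlapping_in_def)
  have bdd: "bdd_above (variation_sums f a t)" if "t \<le> b" for t
    using abs_cont_on_imp_bdd_above_variation_sums[OF ac] sub[OF that] by (rule bdd_above_mono)
  have ne: "variation_sums f a t \<noteq> {}" for t using zero_in_variation_sums by blast
  have super: "norm (f t - f s) \<le> V t - V s" if "a \<le> s" "s \<le> t" "t \<le> b" for s t
  proof -
    have "V s \<le> V t - norm (f t - f s)"
      unfolding V_def[of s]
    proof (rule cSup_least[OF ne])
      fix x assume "x \<in> variation_sums f a s"
      then have "x + norm (f t - f s) \<in> variation_sums f a t"
        using that variation_sums_extend by blast
      then have "x + norm (f t - f s) \<le> V t"
        unfolding V_def using bdd that by (intro cSup_upper) auto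
      then show "x \<le> V t - norm (f t - f s)" by simp
    qed
    then show ?thesis by simp
  qed
  have mono: "V s \<le> V t" if "a \<le> s" "s \<le> t" "t \<le> b" for s t
    using super[OF that] by (smt (verit) norm_ge_zero)
  have "uniformly_continuous_on {a..b} V"
    unfolding uniformly_continuous_on_def
  proof (intro allI impI)
    fix e :: real assume "e > 0"
    then obtain d where d: "0 < d"
      and D: "\<And>a' b' s. \<lbrakk>a \<le> a'; a' \<le> b'; b' \<le> b; b' - a' < d; s \<in> variation_sums f a' b'\<rbrakk> \<Longrightarrow> s < e/2"
      using abs_cont_on_variation_sums_small[OF ac, of "e/2"] by auto
    \<comment> \<open>Taking a supremum weakens a strict bound, so the variation on short intervals
      is kept below \<open>e/2\<close>.\<close>
    have *: "V t - V s < e" if H: "a \<le> s" "s \<le> t" "t \<le> b" "t - s < d" for s t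
    proof -
      have "V t \<le> V s + e/2"
        unfolding V_def[of t]
      proof (rule cSup_least[OF ne])
        fix x assume "x \<in> variation_sums f a t"
        then obtain x1 x2 where x: "x1 \<in> variation_sums f a s" "x2 \<in> variation_sums f s t" "x \<le> x1 + x2"
          using variation_sums_split H by blast
        have "x1 \<le> V s" unfolding V_def using x bdd that by (intro cSup_upper) auto
        moreover have "x2 < e/2" using D x that by blast
        ultimately show "x \<le> V s + e/2" using x by simp
      qed
      then show ?thesis using \<open>e > 0\<close> by simp
    qed
    show "\<exists>d>0. \<forall>x\<in>{a..b}. \<forall>x'\<in>{a..b}. dist x' x < d \<longrightarrow> dist (V x') (V x) < e"
    proof (intro exI[of _ d] conjI d ballI impI)
      fix x x' assume x: "x \<in> {a..b}" "x' \<in> {a..b}" "dist x' x < d"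
      show "dist (V x') (V x) < e"
      proof (cases "x \<le> x'")
        case True
        then show ?thesis using *[of x x'] mono[of x x'] x by (auto simp: dist_real_def)
      next
        case False
        then show ?thesis using *[of x' x] mono[of x' x] x by (auto simp: dist_real_def)
      qed
    qed
  qed
  then have "continuous_on {a..b} V" by (rule uniformly_continuous_imp_continuous)
  with super show ?thesis by (rule that)
qed

section \<open>Differentiability of monotone functions\<close>

text \<open>The Vitali theorem for closed balls, read on the line: an interval is the ball about its
  midpoint with half its length as radius. \<open>R\<close> selects the admissible intervals and
  \<open>U\<close> confines them.\<close>

lemma Vitali_covering_intervals:
  fixes E U :: "real set"
  assumes "open U" "E \<subseteq> U"
    and cover: "\<And>x d. \<lbrakk>x \<in> E; 0 < d\<rbrakk> \<Longrightarrow> \<exists>a b. a < b \<and> a \<le> x \<and> x \<le> b \<and> b - a < d \<and> R a b"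
  obtains C where "countable C" "\<forall>(a, b)\<in>C. a < b \<and> R a b \<and> {a..b} \<subseteq> U"
    "disjoint_family_on (\<lambda>(a, b). {a..b}) C" "negligible (E - (\<Union>(a, b)\<in>C. {a..b}))"
proof -
  define K where "K = {(a, b). a < b \<and> R a b \<and> {a..b} \<subseteq> U}"
  define c r where "c = (\<lambda>(a::real, b). (a + b) / 2)" and "r = (\<lambda>(a::real, b). (b - a) / 2)"
  have cb: "cball (c i) (r i) = (case i of (a, b) \<Rightarrow> {a..b})" for i
    by (auto simp: c_def r_def cball_eq_atLeastAtMost field_simps split: prod.splits)
  have cov: "\<exists>i. i \<in> K \<and> x \<in> cball (c i) (r i) \<and> r i < d" if x: "x \<in> E" and d: "0 < d" for x d
  proof -
    \<comment> \<open>Intervals that contain \<open>x\<close> and are shorter than \<open>e\<close>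
      stay inside \<open>U\<close>.\<close>
    obtain e where e: "0 < e" "cball x e \<subseteq> U"
      using assms x by (meson open_contains_cball subsetD)
    obtain a b where ab: "a < b" "a \<le> x" "x \<le> b" "b - a < min d e" "R a b"
      using cover[OF x, of "min d e"] d e by auto
    have "{a..b} \<subseteq> cball x e" using ab by (auto simp: cball_eq_atLeastAtMost)
    then have "(a, b) \<in> K" using ab e by (auto simp: K_def)
    moreover have "x \<in> cball (c (a, b)) (r (a, b))" using ab by (simp add: cb)
    moreover have "r (a, b) < d" using ab by (simp add: r_def)
    ultimately show ?thesis by blast
  qed
  have pos: "0 < r i" if "i \<in> K" for i using that by (auto simp: K_def r_def)
  obtain C where C: "countable C" "C \<subseteq> K"
     "pairwise (\<lambda>i j. disjnt (cball (c i) (r i)) (cball (c j) (r j))) C"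
     "negligible (E - (\<Union>i \<in> C. cball (c i) (r i)))"
    by (rule Vitali_covering_theorem_cballs[OF pos cov])
  show ?thesis
  proof (rule that[OF C(1)])
    show "\<forall>(a, b)\<in>C. a < b \<and> R a b \<and> {a..b} \<subseteq> U"
      using C(2) by (auto simp: K_def)
    show "disjoint_family_on (\<lambda>(a, b). {a..b}) C"
      using C(3) unfolding cb by (auto simp: disjoint_family_on_def pairwise_def disjnt_def)
    show "negligible (E - (\<Union>(a, b)\<in>C. {a..b}))"
      using C(4) unfolding cb .
  qed
qed

section \<open>Stieltjes and Lebesgue measure of countable disjoint unions of intervals\<close>

lemma borel_UN_intervals: "countable C \<Longrightarrow> (\<Union>(a, b)\<in>C. {a..b::real}) \<in> sets borel"
  by (rule sets.countable_UN') auto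

lemma emeasure_UN_intervals:
  fixes M :: "real measure"
  assumes "countable C" "disjoint_family_on (\<lambda>(a, b). {a..b}) C" "sets M = sets borel"
  shows "emeasure M (\<Union>(a, b)\<in>C. {a..b}) = (\<integral>\<^sup>+(a, b). emeasure M {a..b} \<partial>count_space C)"
  using assms by (subst emeasure_UN_countable) (auto simp: case_prod_unfold)

text \<open>By continuity the Stieltjes measure of \<open>{a..b}\<close> is
  \<open>F b - F a\<close>, so the slope bound on each interval sums over the disjoint
  family.\<close>

lemma interval_measure_UN_intervals_le:
  assumes F: "mono F" "continuous_on UNIV F" and u: "0 \<le> u"
    and C: "countable C" "disjoint_family_on (\<lambda>(a, b). {a..b}) C"
    and le: "\<And>a b. (a, b) \<in> C \<Longrightarrow> a \<le> b \<and> F b - F a \<le> u * (b - a)"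
  shows "emeasure (interval_measure F) (\<Union>(a, b)\<in>C. {a..b}) \<le> ennreal u * emeasure lborel (\<Union>(a, b)\<in>C. {a..b})"
proof -
  have "(\<integral>\<^sup>+(a, b). emeasure (interval_measure F) {a..b} \<partial>count_space C)
      \<le> (\<integral>\<^sup>+i. ennreal u * (case i of (a, b) \<Rightarrow> emeasure lborel {a..b}) \<partial>count_space C)"
    by (rule nn_integral_mono)
      (use le u in \<open>auto simp: emeasure_interval_measure_Icc[OF _ monoD[OF F(1)] F(2)] ennreal_mult[symmetric] intro!: ennreal_leI\<close>)
  also have "\<dots> = ennreal u * (\<integral>\<^sup>+(a, b). emeasure lborel {a..b} \<partial>count_space C)"
    by (rule nn_integral_cmult) simp
  finally show ?thesis
    by (simp add: emeasure_UN_intervals C)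
qed

lemma interval_measure_UN_intervals_ge:
  assumes F: "mono F" "continuous_on UNIV F" and v: "0 \<le> v"
    and C: "countable C" "disjoint_family_on (\<lambda>(a, b). {a..b}) C"
    and ge: "\<And>a b. (a, b) \<in> C \<Longrightarrow> a \<le> b \<and> v * (b - a) \<le> F b - F a"
  shows "ennreal v * emeasure lborel (\<Union>(a, b)\<in>C. {a..b}) \<le> emeasure (interval_measure F) (\<Union>(a, b)\<in>C. {a..b})"
proof -
  have "ennreal v * (\<integral>\<^sup>+(a, b). emeasure lborel {a..b} \<partial>count_space C)
     = (\<integral>\<^sup>+i. ennreal v * (case i of (a, b) \<Rightarrow> emeasure lborel {a..b}) \<partial>count_space C)"
    by (rule nn_integral_cmult[symmetric]) simp
  also have "\<dots> \<le> (\<integral>\<^sup>+(a, b). emeasure (interval_measure F) {a..b} \<partial>count_space C)"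
    by (rule nn_integral_mono)
      (use ge v in \<open>auto simp: emeasure_interval_measure_Icc[OF _ monoD[OF F(1)] F(2)] ennreal_mult[symmetric] intro!: ennreal_leI\<close>)
  finally show ?thesis
    by (simp add: emeasure_UN_intervals C)
qed

text \<open>The sets to be covered are not assumed measurable, hence the outer measure. The part
  missed by a Vitali cover is enclosed in a Borel null set, which adds no measure.\<close>

lemma outer_measure_of_le_of_negligible_Diff:
  fixes E A :: "'a::euclidean_space set"
  assumes "negligible (E - A)" "A \<in> sets borel"
  shows "outer_measure_of lborel E \<le> emeasure lborel A"
proof -
  obtain N where N: "N \<in> null_sets lborel" "E - A \<subseteq> N"
    using assms(1) by (auto simp: negligible_iff_null_sets null_sets_completion_iff2)
  have "outer_measure_of lborel E \<le> outer_measure_of lborel (A \<union> N)"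
    by (rule outer_measure_of_mono) (use N in auto)
  also have "\<dots> = emeasure lborel A"
    using N assms(2) null_setsD2[OF N(1)] by (subst outer_measure_of_eq) (auto simp: emeasure_Un_null_set)
  finally show ?thesis .
qed

lemma outer_measure_of_eq_0_imp_negligible:
  fixes E :: "'a::euclidean_space set"
  assumes "outer_measure_of lborel E = 0"
  shows "negligible E"
proof -
  obtain B where "B \<in> sets lborel" "E \<subseteq> B" "emeasure lborel B = 0"
    using outer_measure_of_attain[of E lborel] assms by auto
  then show ?thesis
    by (meson negligible_iff_null_sets negligible_subset null_setsI null_sets_completionI)
qed

lemma outer_measure_of_bounded_finite:
  fixes E :: "real set"
  assumes "E \<subseteq> {a..b}"
  shows "outer_measure_of lborel E < \<infinity>"
proof -
  have "outer_measure_of lborel E \<le> outer_measure_of lborel {a..b}"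
    by (rule outer_measure_of_mono[OF assms])
  also have "\<dots> < \<infinity>" by (simp add: emeasure_lborel_Icc_eq)
  finally show ?thesis .
qed

text \<open>Division by zero gives the value 0 at \<open>y = x\<close>, so for monotone
  \<open>F\<close> the quotient is nonnegative at every \<open>y\<close>.\<close>

definition diff_quot :: "(real \<Rightarrow> real) \<Rightarrow> real \<Rightarrow> real \<Rightarrow> real" where
  "diff_quot F x y = (F y - F x) / (y - x)"

text \<open>The quotient is symmetric in its two points, so a nearby \<open>y\<close> on either side
  yields an interval with endpoint \<open>x\<close>.\<close>

lemma frequently_diff_quot_interval:
  assumes "frequently (\<lambda>y. R (diff_quot F x y)) (at x)" "0 < d"
  shows "\<exists>a b. a < b \<and> a \<le> x \<and> x \<le> b \<and> b - a < d \<and> R ((F b - F a) / (b - a))"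
proof -
  obtain y where y: "y \<noteq> x" "dist y x < d" "R (diff_quot F x y)"
    using assms unfolding frequently_at by auto
  show ?thesis
  proof (cases "x < y")
    case True
    then show ?thesis using y by (intro exI[of _ x] exI[of _ y]) (auto simp: dist_real_def diff_quot_def)
  next
    case False
    moreover have "diff_quot F x y = (F x - F y) / (x - y)"
      unfolding diff_quot_def by (metis minus_diff_eq minus_divide_divide)
    ultimately show ?thesis using y by (intro exI[of _ y] exI[of _ x]) (auto simp: dist_real_def)
  qed
qed

text \<open>
  Cover E by small intervals of slope at most u, then cover E again by intervals of slope at
  least v inside the first cover. If m is the outer measure of E, comparing the Stieltjes
  measures of the two covers gives v m \<le> u (m + e) for every e > 0.
\<close>

lemma negligible_oscillating_diff_quot:
  fixes F :: "real \<Rightarrow> real"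
  assumes F: "mono F" "continuous_on UNIV F" and uv: "0 \<le> u" "u < v"
    and bdd: "E \<subseteq> {a..b}"
    and lo: "\<And>x. x \<in> E \<Longrightarrow> frequently (\<lambda>y. diff_quot F x y < u) (at x)"
    and hi: "\<And>x. x \<in> E \<Longrightarrow> frequently (\<lambda>y. v < diff_quot F x y) (at x)"
  shows "negligible E"
proof -
  let ?\<mu> = "emeasure (interval_measure F)" and ?\<nu> = "emeasure lborel :: real set \<Rightarrow> ennreal"
  define m where "m = enn2real (outer_measure_of lborel E)"
  have m: "outer_measure_of lborel E = ennreal m" "0 \<le> m"
    using outer_measure_of_bounded_finite[OF bdd] by (auto simp: m_def)
  have lo': "\<exists>a b. a < b \<and> a \<le> x \<and> x \<le> b \<and> b - a < d \<and> F b - F a \<le> u * (b - a)"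
    if x: "x \<in> E" "0 < d" for x d
  proof -
    obtain a b where ab: "a < b" "a \<le> x" "x \<le> b" "b - a < d" "(F b - F a) / (b - a) < u"
      using frequently_diff_quot_interval[OF lo[OF x(1)] x(2)] by blast
    then have "F b - F a \<le> u * (b - a)" by (simp add: pos_divide_less_eq)
    with ab show ?thesis by blast
  qed
  have hi': "\<exists>a b. a < b \<and> a \<le> x \<and> x \<le> b \<and> b - a < d \<and> v * (b - a) \<le> F b - F a"
    if x: "x \<in> E" "0 < d" for x d
  proof -
    obtain a b where ab: "a < b" "a \<le> x" "x \<le> b" "b - a < d" "v < (F b - F a) / (b - a)"
      using frequently_diff_quot_interval[OF hi[OF x(1)] x(2)] by blast
    then have "v * (b - a) \<le> F b - F a" by (simp add: pos_less_divide_eq)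
    with ab show ?thesis by blast
  qed
  \<comment> \<open>\<open>E\<close> may fail to be measurable; its Borel hull \<open>H\<close> has
    the same outer measure and admits outer regularity.\<close>
  obtain H where H: "H \<in> sets borel" "E \<subseteq> H" "?\<nu> H = ennreal m"
    using outer_measure_of_attain[of E lborel] m by auto
  have key: "v * m \<le> u * (m + e)" if e: "0 < e" for e
  proof -
    obtain U where U: "open U" "H \<subseteq> U" "?\<nu> (U - H) < ennreal e"
      using outer_regular_lborel[OF H(1) e] by blast
    have "?\<nu> U = ?\<nu> H + ?\<nu> (U - H)"
      using U H by (subst plus_emeasure) (auto simp: Un_absorb1)
    also have "\<dots> \<le> ennreal m + ennreal e"
      unfolding H(3) using U(3) by (intro add_left_mono) simp
    also have "\<dots> = ennreal (m + e)" using m e by simp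
    finally have lU: "?\<nu> U \<le> ennreal (m + e)" .
    obtain C1 where C1: "countable C1"
        "\<forall>(a, b)\<in>C1. a < b \<and> F b - F a \<le> u * (b - a) \<and> {a..b} \<subseteq> U"
        "disjoint_family_on (\<lambda>(a, b). {a..b}) C1" "negligible (E - (\<Union>(a, b)\<in>C1. {a..b}))"
      by (rule Vitali_covering_intervals[OF U(1) order_trans[OF H(2) U(2)] lo'])
    \<comment> \<open>The second cover has to lie in an open set, hence the interiors. Only the
      countably many endpoints are lost.\<close>
    define A1 U1 where "A1 = (\<Union>(a, b)\<in>C1. {a..b})" and "U1 = (\<Union>(a, b)\<in>C1. {a<..<b})"
    have A1: "A1 \<in> sets borel" "A1 \<subseteq> U" unfolding A1_def using C1 borel_UN_intervals by auto
    have "negligible (fst ` C1 \<union> snd ` C1)"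
      using C1(1) by (simp add: negligible_iff_null_sets null_sets_completionI countable_imp_null_set_lborel)
    moreover have "E - U1 \<subseteq> (E - A1) \<union> (fst ` C1 \<union> snd ` C1)"
      by (force simp: A1_def U1_def)
    ultimately have nU1: "negligible (E - U1)"
      using C1(4) unfolding A1_def by (meson negligible_Un negligible_subset)
    have oU1: "open U1" unfolding U1_def by auto
    obtain C2 where C2: "countable C2"
        "\<forall>(a, b)\<in>C2. a < b \<and> v * (b - a) \<le> F b - F a \<and> {a..b} \<subseteq> U1"
        "disjoint_family_on (\<lambda>(a, b). {a..b}) C2" "negligible (E \<inter> U1 - (\<Union>(a, b)\<in>C2. {a..b}))"
      by (rule Vitali_covering_intervals[OF oU1 Int_lower2 hi'[OF IntD1]])
    define A2 where "A2 = (\<Union>(a, b)\<in>C2. {a..b})"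
    have "A2 \<subseteq> U1" unfolding A2_def by (rule UN_least) (use C2(2) in auto)
    moreover have "U1 \<subseteq> A1" unfolding U1_def A1_def by (rule UN_mono) auto
    ultimately have A2: "A2 \<in> sets borel" "A2 \<subseteq> A1"
      using borel_UN_intervals[OF C2(1)] by (auto simp: A2_def)
    have "negligible (E - A2)"
      by (rule negligible_subset[OF negligible_Un[OF nU1 C2(4)]]) (auto simp: A2_def)
    then have "ennreal m \<le> ?\<nu> A2"
      using outer_measure_of_le_of_negligible_Diff A2 m by metis
    then have "ennreal v * ennreal m \<le> ennreal v * ?\<nu> A2" by (rule mult_left_mono) simp
    also have "\<dots> \<le> ?\<mu> A2"
      unfolding A2_def using C2 uv by (intro interval_measure_UN_intervals_ge F) (auto intro: less_imp_le)
    also have "\<dots> \<le> ?\<mu> A1" using A1 A2 by (intro emeasure_mono) auto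
    also have "\<dots> \<le> ennreal u * ?\<nu> A1"
      unfolding A1_def using C1 uv by (intro interval_measure_UN_intervals_le F) (auto intro: less_imp_le)
    also have "\<dots> \<le> ennreal u * ?\<nu> U"
      using A1 U(1) by (intro mult_left_mono emeasure_mono) auto
    also have "\<dots> \<le> ennreal u * ennreal (m + e)"
      using lU by (rule mult_left_mono) simp
    finally show ?thesis
      using m uv e by (simp add: ennreal_mult[symmetric] del: ennreal_plus)
  qed
  have "m = 0"
  proof (rule ccontr)
    assume "m \<noteq> 0"
    then have pos: "0 < (v - u) * m" using m uv by simp
    \<comment> \<open>The denominator is positive even for \<open>u = 0\<close>, and this choice
      makes \<open>u * e < (v - u) * m\<close>, contradicting \<open>key\<close>.\<close>
    define e where "e = (v - u) * m / (u + 1)"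
    have "0 < e" using pos uv by (simp add: e_def)
    then have "(v - u) * m \<le> u * e" using key[of e] by (simp add: algebra_simps)
    moreover have "u * e < (u + 1) * e" using \<open>0 < e\<close> by simp
    moreover have "(u + 1) * e = (v - u) * m" using uv by (simp add: e_def)
    ultimately show False by simp
  qed
  then show ?thesis using m outer_measure_of_eq_0_imp_negligible by simp
qed

text \<open>Disjoint intervals of slope at least \<open>v\<close> inside \<open>{a<..<b}\<close>
  cover \<open>E\<close> up to a null set, and their Stieltjes measure is at most
  \<open>F b - F a\<close>. So \<open>v\<close> times the outer measure of \<open>E\<close> stays
  bounded for all \<open>v\<close>.\<close>

lemma negligible_unbounded_diff_quot:
  fixes F :: "real \<Rightarrow> real"
  assumes F: "mono F" "continuous_on UNIV F"
    and bdd: "E \<subseteq> {a<..<b}"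
    and hi: "\<And>x v. x \<in> E \<Longrightarrow> frequently (\<lambda>y. v < diff_quot F x y) (at x)"
  shows "negligible E"
proof (cases "a \<le> b")
  case False
  then show ?thesis using bdd by auto
next
  case True
  let ?\<mu> = "emeasure (interval_measure F)" and ?\<nu> = "emeasure lborel :: real set \<Rightarrow> ennreal"
  define m where "m = enn2real (outer_measure_of lborel E)"
  have m: "outer_measure_of lborel E = ennreal m" "0 \<le> m"
    using outer_measure_of_bounded_finite[of E a b] bdd by (force simp: m_def)+
  have key: "v * m \<le> F b - F a" if v: "0 \<le> v" for v
  proof -
    have hi': "\<exists>a b. a < b \<and> a \<le> x \<and> x \<le> b \<and> b - a < d \<and> v * (b - a) \<le> F b - F a"
      if x: "x \<in> E" "0 < d" for x d
    proof -
      obtain a b where ab: "a < b" "a \<le> x" "x \<le> b" "b - a < d" "v < (F b - F a) / (b - a)"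
        using frequently_diff_quot_interval[OF hi[OF x(1)] x(2)] by blast
      then have "v * (b - a) \<le> F b - F a" by (simp add: pos_less_divide_eq)
      with ab show ?thesis by blast
    qed
    obtain C where C: "countable C"
        "\<forall>(c, d)\<in>C. c < d \<and> v * (d - c) \<le> F d - F c \<and> {c..d} \<subseteq> {a<..<b}"
        "disjoint_family_on (\<lambda>(a, b). {a..b}) C" "negligible (E - (\<Union>(a, b)\<in>C. {a..b}))"
      by (rule Vitali_covering_intervals[OF open_greaterThanLessThan bdd hi'])
    define A where "A = (\<Union>(a, b)\<in>C. {a..b})"
    have "A \<subseteq> {a<..<b}" unfolding A_def by (rule UN_least) (use C(2) in auto)
    then have A: "A \<in> sets borel" "A \<subseteq> {a<..<b}"
      using borel_UN_intervals[OF C(1)] by (auto simp: A_def)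
    have "ennreal m \<le> ?\<nu> A"
      using outer_measure_of_le_of_negligible_Diff[of E A] A C(4) m unfolding A_def by metis
    then have "ennreal v * ennreal m \<le> ennreal v * ?\<nu> A" by (rule mult_left_mono) simp
    also have "\<dots> \<le> ?\<mu> A"
      unfolding A_def using C v by (intro interval_measure_UN_intervals_ge F) (auto intro: less_imp_le)
    also have "\<dots> \<le> ?\<mu> {a..b}" using A by (intro emeasure_mono) auto
    also have "\<dots> = ennreal (F b - F a)"
      using True by (rule emeasure_interval_measure_Icc[OF _ monoD[OF F(1)] F(2)])
    finally show ?thesis
      using m v monoD[OF F(1) True] by (simp add: ennreal_mult[symmetric])
  qed
  have "m = 0"
  proof (rule ccontr)
    assume "m \<noteq> 0"
    then have "0 < m" using m by simp
    moreover have "0 \<le> (F b - F a + 1) / m" using \<open>0 < m\<close> monoD[OF F(1) True] by simp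
    \<comment> \<open>This slope would give \<open>F b - F a + 1 \<le> F b - F a\<close>.\<close>
    ultimately show False using key[of "(F b - F a + 1) / m"] by simp
  qed
  then show ?thesis using m outer_measure_of_eq_0_imp_negligible by simp
qed

text \<open>The lower and upper limits of the quotient exist in the extended reals. They agree, as
  otherwise two rationals separate them, and the common value is finite by \<open>nonneg\<close> and
  \<open>bdd\<close>.\<close>

lemma differentiable_if_diff_quot_tame:
  assumes nonneg: "\<And>y. 0 \<le> diff_quot F x y"
    and bdd: "\<not> (\<forall>v. frequently (\<lambda>y. v < diff_quot F x y) (at x))"
    and osc: "\<And>u v. \<lbrakk>u \<in> \<rat>; v \<in> \<rat>; 0 \<le> u; u < v; frequently (\<lambda>y. diff_quot F x y < u) (at x)\<rbrakk>
       \<Longrightarrow> \<not> frequently (\<lambda>y. v < diff_quot F x y) (at x)"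
  shows "F differentiable (at x)"
proof -
  let ?q = "\<lambda>y. ereal (diff_quot F x y)"
  define l L where "l = Liminf (at x) ?q" and "L = Limsup (at x) ?q"
  obtain v where "eventually (\<lambda>y. diff_quot F x y \<le> v) (at x)"
    using bdd by (auto simp: not_frequently not_less)
  then have "L \<le> ereal v" unfolding L_def by (intro Limsup_bounded) (auto elim: eventually_mono)
  have "0 \<le> l" unfolding l_def by (intro Liminf_bounded always_eventually) (simp add: nonneg)
  have "l \<le> L" unfolding l_def L_def by (rule Liminf_le_Limsup) simp
  have "\<not> l < L"
  proof
    assume "l < L"
    \<comment> \<open>The limits may be infinite, so real levels \<open>u < w < z\<close> between
      them come first; the rationals \<open>u'\<close> and \<open>v'\<close> are then taken on
      either side of \<open>w\<close>.\<close>
    then obtain w where w: "l < ereal w" "ereal w < L" using ereal_dense2 by blast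
    obtain u where u: "l < ereal u" "ereal u < ereal w" using w(1) ereal_dense2 by blast
    obtain u' where u': "u' \<in> \<rat>" "u < u'" "u' < w" using Rats_dense_in_real[of u w] u by auto
    obtain z where z: "ereal w < ereal z" "ereal z < L" using w(2) ereal_dense2 by blast
    obtain v' where v': "v' \<in> \<rat>" "w < v'" "v' < z" using Rats_dense_in_real[of w z] z by auto
    have lu: "l < ereal u'" using u u' by (meson ereal_less_eq(3) less_imp_le order_less_le_trans)
    have vL: "ereal v' < L" using z v' by (meson ereal_less_eq(3) less_imp_le order_le_less_trans)
    have "0 \<le> u'" using \<open>0 \<le> l\<close> lu by (metis ereal_less_eq(5) less_imp_le order_trans)
    moreover have "frequently (\<lambda>y. diff_quot F x y < u') (at x)"
    proof (rule ccontr)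
      assume "\<not> frequently (\<lambda>y. diff_quot F x y < u') (at x)"
      then have "eventually (\<lambda>y. ereal u' \<le> ?q y) (at x)" by (simp add: not_frequently not_less)
      then have "ereal u' \<le> l" unfolding l_def by (rule Liminf_bounded)
      with lu show False by simp
    qed
    moreover have "frequently (\<lambda>y. v' < diff_quot F x y) (at x)"
    proof (rule ccontr)
      assume "\<not> frequently (\<lambda>y. v' < diff_quot F x y) (at x)"
      then have "eventually (\<lambda>y. ?q y \<le> ereal v') (at x)" by (simp add: not_frequently not_less)
      then have "L \<le> ereal v'" unfolding L_def by (rule Limsup_bounded)
      with vL show False by simp
    qed
    ultimately show False using osc[of u' v'] u' v' by simp
  qed
  with \<open>l \<le> L\<close> have "l = L" by simp
  moreover obtain D where "L = ereal D"
    using \<open>L \<le> ereal v\<close> \<open>0 \<le> l\<close> \<open>l = L\<close> by (cases L) auto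
  ultimately have "(?q \<longlongrightarrow> ereal D) (at x)"
    unfolding l_def L_def by (intro Liminf_eq_Limsup) auto
  then have "(diff_quot F x \<longlongrightarrow> D) (at x)" by (simp add: o_def)
  then have "(F has_field_derivative D) (at x)"
    by (simp add: has_field_derivative_iff diff_quot_def[abs_def])
  then show ?thesis using field_differentiable_def field_differentiable_imp_differentiable by blast
qed

text \<open>Points of non-differentiability lie in a countable union of null sets: those where the
  quotient oscillates across a rational pair and those where it is unbounded above, each cut to
  bounded windows.\<close>

lemma mono_continuous_imp_AE_differentiable:
  fixes F :: "real \<Rightarrow> real"
  assumes F: "mono F" "continuous_on UNIV F"
  shows "AE x in lborel. F differentiable (at x)"
proof -
  define O1 where "O1 = (\<lambda>(n::nat, u, v). {x \<in> {- real n..real n}.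
    frequently (\<lambda>y. diff_quot F x y < u) (at x) \<and> frequently (\<lambda>y. v < diff_quot F x y) (at x)})"
  define O2 where "O2 n = {x \<in> {- real n<..<real n}.
    \<forall>v. frequently (\<lambda>y. v < diff_quot F x y) (at x)}" for n :: nat
  define I where "I = {(n::nat, u, v). u \<in> \<rat> \<and> v \<in> \<rat> \<and> 0 \<le> u \<and> u < (v::real)}"
  have "countable (UNIV \<times> \<rat> \<times> \<rat> :: (nat \<times> real \<times> real) set)"
    by (intro countable_SIGMA countable_rat) auto
  then have "countable I" by (rule countable_subset[rotated]) (auto simp: I_def)
  then have "negligible (\<Union>i\<in>I. O1 i)"
    by (intro negligible_countable_Union countable_image)
      (auto simp: I_def O1_def intro!: negligible_oscillating_diff_quot[OF F])
  moreover have "negligible (\<Union>n. O2 n)"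
    by (intro negligible_countable_Union countable_image)
      (auto simp: O2_def intro!: negligible_unbounded_diff_quot[OF F])
  ultimately have N: "negligible ((\<Union>i\<in>I. O1 i) \<union> (\<Union>n. O2 n))" by (rule negligible_Un)
  have "{x. \<not> F differentiable (at x)} \<subseteq> (\<Union>i\<in>I. O1 i) \<union> (\<Union>n. O2 n)"
  proof (rule subsetI, rule ccontr)
    fix x assume x: "x \<in> {x. \<not> F differentiable (at x)}" "x \<notin> (\<Union>i\<in>I. O1 i) \<union> (\<Union>n. O2 n)"
    obtain n :: nat where n: "\<bar>x\<bar> < n" using reals_Archimedean2 by blast
    have "F differentiable (at x)"
    proof (rule differentiable_if_diff_quot_tame)
      show "0 \<le> diff_quot F x y" for y
        using monoD[OF F(1)] unfolding diff_quot_def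
        by (cases "x \<le> y") (auto intro: divide_nonneg_nonneg divide_nonpos_nonpos)
      show "\<not> (\<forall>v. frequently (\<lambda>y. v < diff_quot F x y) (at x))"
        using x n by (auto simp: O2_def abs_less_iff)
      show "\<not> frequently (\<lambda>y. v < diff_quot F x y) (at x)"
        if "u \<in> \<rat>" "v \<in> \<rat>" "0 \<le> u" "u < v" "frequently (\<lambda>y. diff_quot F x y < u) (at x)" for u v
      proof -
        have "(n, u, v) \<in> I" using that by (simp add: I_def)
        then have "x \<notin> O1 (n, u, v)" using x by blast
        then show ?thesis using n that by (auto simp: O1_def)
      qed
    qed
    with x show False by simp
  qed
  with N have "negligible {x. \<not> F differentiable (at x)}" by (rule negligible_subset)
  then have "AE x in lebesgue. F differentiable (at x)"
    by (auto simp: negligible_iff_null_sets eventually_ae_filter)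
  then show ?thesis by (simp add: AE_completion_iff)
qed

lemma abs_cont_on_imp_AE_differentiable:
  fixes f :: "real \<Rightarrow> real^'n::finite"
  assumes ac: "abs_cont_on a b f" and ab: "a \<le> b"
  shows "AE t in lborel. t \<in> {a<..<b} \<longrightarrow> f differentiable (at t)"
proof -
  obtain V :: "real \<Rightarrow> real" where
    V: "\<And>s t. \<lbrakk>a \<le> s; s \<le> t; t \<le> b\<rbrakk> \<Longrightarrow> norm (f t - f s) \<le> V t - V s"
    and cV: "continuous_on {a..b} V"
    using abs_cont_on_imp_monotone_majorant[OF ac ab] by blast
  \<comment> \<open>Clamping extends \<open>f\<close> and \<open>V\<close> as constants past the
    endpoints, so that the result for the whole line applies.\<close>
  define c where "c t = max a (min b t)" for t
  have c: "a \<le> c t" "c t \<le> b" for t using ab by (auto simp: c_def)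
  have c_mono: "c s \<le> c t" if "s \<le> t" for s t using that by (auto simp: c_def)
  have c_id: "c t = t" if "t \<in> {a<..<b}" for t using that by (auto simp: c_def)
  have cont_c: "continuous_on UNIV c" unfolding c_def by (intro continuous_intros)
  have c_img: "c ` UNIV \<subseteq> {a..b}" using c by auto
  have Vc: "norm (f (c t) - f (c s)) \<le> V (c t) - V (c s)" if "s \<le> t" for s t
    using V c c_mono[OF that] by blast
  have "continuous_on {a..b} f"
    unfolding continuous_on_iff
  proof (intro ballI allI impI)
    fix s e :: real assume s: "s \<in> {a..b}" and "0 < e"
    then obtain d where d: "0 < d" "\<And>t. t \<in> {a..b} \<Longrightarrow> dist t s < d \<Longrightarrow> dist (V t) (V s) < e"
      using cV unfolding continuous_on_iff by meson
    have "dist (f t) (f s) < e" if t: "t \<in> {a..b}" "dist t s < d" for t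
      using d(2)[OF t] V[of s t] V[of t s] s t
      by (cases "s \<le> t") (auto simp: dist_norm norm_minus_commute)
    with d show "\<exists>d>0. \<forall>t\<in>{a..b}. dist t s < d \<longrightarrow> dist (f t) (f s) < e" by blast
  qed
  then have cont_fc: "continuous_on UNIV (\<lambda>t. f (c t))"
    using continuous_on_compose2[OF _ cont_c c_img] by blast
  have cont_Vc: "continuous_on UNIV (\<lambda>t. V (c t))"
    using continuous_on_compose2[OF cV cont_c c_img] by blast
  have "mono (\<lambda>t. V (c t))"
    using order_trans[OF norm_ge_zero Vc] by (intro monoI) simp
  then have AE_V: "AE t in lborel. (\<lambda>t. V (c t)) differentiable (at t)"
    using cont_Vc by (rule mono_continuous_imp_AE_differentiable)
  \<comment> \<open>The increments of \<open>V\<close> dominate those of every component, so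
    subtracting a component keeps monotonicity.\<close>
  have "mono (\<lambda>t. V (c t) - f (c t) $ i)" for i
  proof (rule monoI)
    fix s t :: real assume "s \<le> t"
    have "f (c t) $ i - f (c s) $ i \<le> norm (f (c t) - f (c s))"
      using component_le_norm_cart[of "f (c t) - f (c s)" i] by simp
    with Vc[OF \<open>s \<le> t\<close>] show "V (c s) - f (c s) $ i \<le> V (c t) - f (c t) $ i" by simp
  qed
  then have "AE t in lborel. (\<lambda>t. V (c t) - f (c t) $ i) differentiable (at t)" for i
    using cont_Vc cont_fc
    by (intro mono_continuous_imp_AE_differentiable) (auto intro!: continuous_intros)
  then have "AE t in lborel. \<forall>i. (\<lambda>t. V (c t) - f (c t) $ i) differentiable (at t)"
    by (simp add: AE_all_countable)
  with AE_V show ?thesis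
  proof eventually_elim
    case (elim t)
    show ?case
    proof
      assume t: "t \<in> {a<..<b}"
      have "(\<lambda>t. f t $ i) differentiable (at t)" for i
      proof -
        have "(\<lambda>t. V (c t) - (V (c t) - f (c t) $ i)) differentiable (at t)"
          by (rule differentiable_diff) (use elim in auto)
        then obtain D where "((\<lambda>t. f (c t) $ i) has_derivative D) (at t)"
          by (auto simp: differentiable_def)
        \<comment> \<open>Differentiability is local, and the clamp is the identity near
          \<open>t\<close>.\<close>
        then have "((\<lambda>t. f t $ i) has_derivative D) (at t)"
          by (rule has_derivative_transform_within_open[where s = "{a<..<b}"]) (use t c_id in auto)
        then show ?thesis by (auto simp: differentiable_def)
      qed
      then show "f differentiable (at t)"
        unfolding differentiable_componentwise_within[of f t UNIV]
        by (auto simp: Basis_vec_def inner_axis)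
    qed
  qed
qed

section \<open>The feedback interconnection\<close>

text \<open>The intervals \<open>{0<..<real n}\<close> exhaust the positive times. Time 0 is
  discarded as a null set, since a two-sided derivative there would involve negative times, where
  nothing is assumed.\<close>

lemma is_system_AE_differentiable:
  assumes "is_system S" "(x, u, y) \<in> S"
  shows "AE t in lborel. t \<ge> 0 \<longrightarrow> x differentiable (at t)"
proof -
  have "AE t in lborel. t \<in> {0<..<real n} \<longrightarrow> x differentiable (at t)" for n :: nat
    using assms by (intro abs_cont_on_imp_AE_differentiable) (auto simp: is_system_def)
  then have "AE t in lborel. \<forall>n::nat. t \<in> {0<..<real n} \<longrightarrow> x differentiable (at t)"
    unfolding AE_all_countable by blast
  moreover have "AE t in lborel. t \<noteq> (0::real)" by (rule AE_lborel_singleton)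
  ultimately show ?thesis
  proof eventually_elim
    case (elim t)
    obtain n :: nat where "t < n" using reals_Archimedean2 by blast
    with elim show ?case by auto
  qed
qed

text \<open>Serves dissipativity and dominance alike: the inequalities of the two systems are added
  at almost every time, with the smaller of the two constants.\<close>

lemma feedback_dissipation_inequality:
  assumes sys: "is_system S1" "is_system S2" and R1: "transpose R1 = R1"
    and d1: "\<forall>(x1, u1, y1)\<in>S1. \<forall>(x2, u2, y2)\<in>S1. AE t in lborel. t \<ge> 0 \<longrightarrow>
      diss_form P1 \<gamma> \<epsilon>1 (vector_derivative x1 (at t) - vector_derivative x2 (at t)) (x1 t - x2 t)
        \<le> block_supply Q1 L1 R1 (y1 t - y2 t) (u1 t - u2 t)"
    and d2: "\<forall>(x1, u1, y1)\<in>S2. \<forall>(x2, u2, y2)\<in>S2. AE t in lborel. t \<ge> 0 \<longrightarrow>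
      diss_form P2 \<gamma> \<epsilon>2 (vector_derivative x1 (at t) - vector_derivative x2 (at t)) (x1 t - x2 t)
        \<le> block_supply Q2 L2 R2 (y1 t - y2 t) (u1 t - u2 t)"
    and xa: "(xa, va, ya) \<in> feedback S1 S2" and xb: "(xb, vb, yb) \<in> feedback S1 S2"
  shows "AE t in lborel. t \<ge> 0 \<longrightarrow>
    diss_form (block_diag P1 P2) \<gamma> (min \<epsilon>1 \<epsilon>2)
        (vector_derivative xa (at t) - vector_derivative xb (at t)) (xa t - xb t)
      \<le> fb_supply Q1 L1 R1 Q2 L2 R2 (ya t - yb t) (va t - vb t)"
proof -
  obtain x1 u1 y1 x2 u2 y2 where a: "(x1, u1, y1) \<in> S1" "(x2, u2, y2) \<in> S2"
    and a_eq: "\<And>t. xa t = vstack (x1 t) (x2 t)" "\<And>t. ya t = vstack (y1 t) (y2 t)"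
      "\<And>t. u1 t = - y2 t + vtop (va t)" "\<And>t. u2 t = y1 t + vbot (va t)"
    using xa unfolding feedback_def by auto
  obtain x1' u1' y1' x2' u2' y2' where b: "(x1', u1', y1') \<in> S1" "(x2', u2', y2') \<in> S2"
    and b_eq: "\<And>t. xb t = vstack (x1' t) (x2' t)" "\<And>t. yb t = vstack (y1' t) (y2' t)"
      "\<And>t. u1' t = - y2' t + vtop (vb t)" "\<And>t. u2' t = y1' t + vbot (vb t)"
    using xb unfolding feedback_def by auto
  have "AE t in lborel. t \<ge> 0 \<longrightarrow>
      diss_form P1 \<gamma> \<epsilon>1 (vector_derivative x1 (at t) - vector_derivative x1' (at t)) (x1 t - x1' t)
        \<le> block_supply Q1 L1 R1 (y1 t - y1' t) (u1 t - u1' t)"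
    using bspec[OF d1 a(1)] b(1) by auto
  moreover have "AE t in lborel. t \<ge> 0 \<longrightarrow>
      diss_form P2 \<gamma> \<epsilon>2 (vector_derivative x2 (at t) - vector_derivative x2' (at t)) (x2 t - x2' t)
        \<le> block_supply Q2 L2 R2 (y2 t - y2' t) (u2 t - u2' t)"
    using bspec[OF d2 a(2)] b(2) by auto
  moreover note is_system_AE_differentiable[OF sys(1) a(1)] is_system_AE_differentiable[OF sys(2) a(2)]
    is_system_AE_differentiable[OF sys(1) b(1)] is_system_AE_differentiable[OF sys(2) b(2)]
  ultimately show ?thesis
  proof eventually_elim
    case (elim t)
    show ?case
    proof
      assume t: "0 \<le> t"
      have dv: "vector_derivative (\<lambda>t. vstack (f t) (g t)) (at t)
          = vstack (vector_derivative f (at t)) (vector_derivative g (at t))"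
        if "f differentiable (at t)" "g differentiable (at t)" for f :: "real \<Rightarrow> real^'a" and g :: "real \<Rightarrow> real^'d"
        using that by (intro vector_derivative_at has_vector_derivative_vstack)
          (simp_all add: vector_derivative_works)
      have x_eq: "xa = (\<lambda>t. vstack (x1 t) (x2 t))" "xb = (\<lambda>t. vstack (x1' t) (x2' t))"
        using a_eq(1) b_eq(1) by auto
      have "diss_form (block_diag P1 P2) \<gamma> (min \<epsilon>1 \<epsilon>2)
          (vector_derivative xa (at t) - vector_derivative xb (at t)) (xa t - xb t)
        = diss_form P1 \<gamma> (min \<epsilon>1 \<epsilon>2) (vector_derivative x1 (at t) - vector_derivative x1' (at t)) (x1 t - x1' t)
        + diss_form P2 \<gamma> (min \<epsilon>1 \<epsilon>2) (vector_derivative x2 (at t) - vector_derivative x2' (at t)) (x2 t - x2' t)"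
        using elim t by (simp add: x_eq dv vstack_diff diss_form_block_diag)
      also have "\<dots> \<le> diss_form P1 \<gamma> \<epsilon>1 (vector_derivative x1 (at t) - vector_derivative x1' (at t)) (x1 t - x1' t)
        + diss_form P2 \<gamma> \<epsilon>2 (vector_derivative x2 (at t) - vector_derivative x2' (at t)) (x2 t - x2' t)"
        by (intro add_mono diss_form_mono) auto
      also have "\<dots> \<le> block_supply Q1 L1 R1 (y1 t - y1' t) (u1 t - u1' t)
        + block_supply Q2 L2 R2 (y2 t - y2' t) (u2 t - u2' t)"
        using elim t by (intro add_mono) auto
      \<comment> \<open>The interconnection equations bring the internal input differences into the
        form of \<open>fb_supply_eq_block_supply\<close>.\<close>
      also have "u1 t - u1' t = vtop (va t - vb t) - (y2 t - y2' t)"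
        by (simp add: a_eq b_eq vtop_diff)
      also have "u2 t - u2' t = (y1 t - y1' t) + vbot (va t - vb t)"
        by (simp add: a_eq b_eq vbot_diff)
      finally show "diss_form (block_diag P1 P2) \<gamma> (min \<epsilon>1 \<epsilon>2)
          (vector_derivative xa (at t) - vector_derivative xb (at t)) (xa t - xb t)
        \<le> fb_supply Q1 L1 R1 Q2 L2 R2 (ya t - yb t) (va t - vb t)"
        by (simp only: a_eq(2) b_eq(2) vstack_diff fb_supply_eq_block_supply[OF R1])
    qed
  qed
qed

theorem theorem2:
  fixes S1 :: "('n1::finite, 'q::finite, 'p::finite) traj set"
    and S2 :: "('n2::finite, 'p, 'q) traj set"
    and Q1 :: "real^'p^'p" and L1 :: "real^'q^'p" and R1 :: "real^'q^'q"
    and Q2 :: "real^'q^'q" and L2 :: "real^'p^'q" and R2 :: "real^'p^'p"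
    and p1 p2 :: nat and \<gamma> :: real
  assumes "is_system S1" and "is_system S2"
    and "\<gamma> \<ge> 0"
    and "transpose Q1 = Q1" and "transpose R1 = R1"
    and "transpose Q2 = Q2" and "transpose R2 = R2"
  shows "\<forall>strict \<in> {False, True}.
           p_dissipative strict S1 p1 \<gamma> (block_supply Q1 L1 R1) \<and>
           p_dissipative strict S2 p2 \<gamma> (block_supply Q2 L2 R2) \<longrightarrow>
             p_dissipative strict (feedback S1 S2) (p1 + p2) \<gamma> (fb_supply Q1 L1 R1 Q2 L2 R2) \<and>
             (fb_lmi Q1 L1 R1 Q2 L2 R2 \<longrightarrow> p_dominant strict (feedback S1 S2) (p1 + p2) \<gamma>)"
proof (intro ballI impI, elim conjE)
  fix strict
  assume "p_dissipative strict S1 p1 \<gamma> (block_supply Q1 L1 R1)"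
  then obtain P1 \<epsilon>1 where P1: "transpose P1 = P1" "has_inertia P1 p1"
    "if strict then \<epsilon>1 > 0 else \<epsilon>1 \<ge> 0"
    and d1: "\<forall>(x1, u1, y1)\<in>S1. \<forall>(x2, u2, y2)\<in>S1. AE t in lborel. t \<ge> 0 \<longrightarrow>
      diss_form P1 \<gamma> \<epsilon>1 (vector_derivative x1 (at t) - vector_derivative x2 (at t)) (x1 t - x2 t)
        \<le> block_supply Q1 L1 R1 (y1 t - y2 t) (u1 t - u2 t)"
    unfolding p_dissipative_def by blast
  assume "p_dissipative strict S2 p2 \<gamma> (block_supply Q2 L2 R2)"
  then obtain P2 \<epsilon>2 where P2: "transpose P2 = P2" "has_inertia P2 p2"
    "if strict then \<epsilon>2 > 0 else \<epsilon>2 \<ge> 0"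
    and d2: "\<forall>(x1, u1, y1)\<in>S2. \<forall>(x2, u2, y2)\<in>S2. AE t in lborel. t \<ge> 0 \<longrightarrow>
      diss_form P2 \<gamma> \<epsilon>2 (vector_derivative x1 (at t) - vector_derivative x2 (at t)) (x1 t - x2 t)
        \<le> block_supply Q2 L2 R2 (y1 t - y2 t) (u1 t - u2 t)"
    unfolding p_dissipative_def by blast
  \<comment> \<open>The minimum is positive, respectively nonnegative, when both constants are, so
    the strict and the plain case are treated together.\<close>
  let ?P = "block_diag P1 P2" and ?\<epsilon> = "min \<epsilon>1 \<epsilon>2"
  have P: "transpose ?P = ?P" "has_inertia ?P (p1 + p2)" "if strict then ?\<epsilon> > 0 else ?\<epsilon> \<ge> 0"
    using P1 P2 by (auto simp: transpose_block_diag has_inertia_block_diag split: if_splits)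
  note ineq = feedback_dissipation_inequality[OF assms(1,2,5) d1 d2]
  show "p_dissipative strict (feedback S1 S2) (p1 + p2) \<gamma> (fb_supply Q1 L1 R1 Q2 L2 R2) \<and>
      (fb_lmi Q1 L1 R1 Q2 L2 R2 \<longrightarrow> p_dominant strict (feedback S1 S2) (p1 + p2) \<gamma>)"
  proof (intro conjI impI)
    show "p_dissipative strict (feedback S1 S2) (p1 + p2) \<gamma> (fb_supply Q1 L1 R1 Q2 L2 R2)"
      unfolding p_dissipative_def
      by (rule exI[of _ ?P], rule exI[of _ ?\<epsilon>]) (use P ineq in blast)
    assume lmi: "fb_lmi Q1 L1 R1 Q2 L2 R2"
    \<comment> \<open>Equal inputs make \<open>va t - vb t\<close> zero, and the supply is then
      nonpositive by \<open>fb_lmi\<close>.\<close>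
    have "AE t in lborel. t \<ge> 0 \<longrightarrow>
        diss_form ?P \<gamma> ?\<epsilon> (vector_derivative xa (at t) - vector_derivative xb (at t)) (xa t - xb t) \<le> 0"
      if mem: "(xa, va, ya) \<in> feedback S1 S2" "(xb, vb, yb) \<in> feedback S1 S2" and v: "\<forall>t. va t = vb t"
      for xa va ya xb vb yb
      using ineq[OF mem]
    proof eventually_elim
      case (elim t)
      with v fb_supply_zero_le[OF lmi, of "ya t - yb t"] show ?case by auto
    qed
    then show "p_dominant strict (feedback S1 S2) (p1 + p2) \<gamma>"
      unfolding p_dominant_def
      by (intro exI[of _ ?P] exI[of _ ?\<epsilon>]) (use P in blast)
  qed
qed

end
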